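(* Let $\alpha$ be a confluent non-expansive partial action of a monoid $M$ on a weak pseudometric space $(X,d)$ (with a fixed witnessing confluent presentation $\langle G\mid R\rangle$ of $M$), and let $(Y,D)$ be its free (weak pseudometric) globalization. If $u,v\in M$ are $C$-elements and $x,y\in X$ are such that $u\cdot x$ and $v\cdot y$ are normal, then there exists a geodesic path from $a=[u,x]$ to $b=[v,y]$. In particular, if $\alpha$ is compact, then there exists a geodesic path for every pair of elements of $Y$.
   Context: A weak pseudometric on $X$ is a symmetric function $d:X\times X\to[0,\infty]$ satisfying the triangle inequality and $d(x,x)=0$. Topological notions refer to the topology induced by $d$. Partial action: a partial map $M\times X\to X$, $(u,x)\mapsto u\cdot x$, with $e\cdot x=x$ for all $x$ ($e$ the unit of $M$) and such that, whenever $v\cdot x$ is defined, $(uv)\cdot x$ is defined iff $u\cdot(v\cdot x)$ is defined, in which case they are equal. $\operatorname{dom}(u)$ is the set of $x\in X$ with $u\cdot x$ defined. It is non-expansive if $d(u\cdot x,u\cdot y)\le d(x,y)$ for all $u\in M$, $x,y\in\operatorname{dom}(u)$. Globalization: $Y=(M\times X)/{\simeq}$, where $\simeq$ is the equivalence relation generated by $(uv,x)\sim(u,v\cdot x)$ whenever $v\cdot x$ is defined; $[u,x]$ is the class of $(u,x)$. $M$ acts on $Y$ by $u\cdot[v,x]=[uv,x]$. A path $\pi$ from $a$ to $b$ in $Y$ is a finite sequence $((u_j,x_j,y_j))_{j=1}^n$, $n\ge1$, $u_j\in M$, $x_j,y_j\in X$, with $[u_1,x_1]=a$, $[u_j,y_j]=[u_{j+1},x_{j+1}]$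 for $1\le j<n$, and $[u_n,y_n]=b$; its length is $D(\pi)=\sum_{j=1}^n d(x_j,y_j)$. The distance is $D(a,b)=\inf_\pi D(\pi)$ over all paths from $a$ to $b$ (with $D(a,b)=\infty$ if there is no such path). A path $\pi$ from $a$ to $b$ is geodesic if $D(\pi)=D(a,b)$. Confluence: A monoid presentation $\langle G\mid R\rangle$ consists of a set $G$ and a set $R\subset G^*\times G^*$ of directed reduction rules $l\to r$ ($G^*$ is the set of finite words over $G$). It induces a one-step reduction $w_1lw_2\to w_1rw_2$ on $G^*$; the presented monoid is $G^*$ modulo the equivalence relation generated by $\to$. A word is normal if no one-step reduction applies to it; a normal form of $w$ is a normal word equivalent to $w$. The presentation is confluent if there is no infinite sequence of one-step reductions, every word has a unique normal form, and no rule has a left side consisting of a single letter. Given a presentation of $M$, one-step reduction on $G^*\times X$ is defined by $(g_n\dots g_1,x)\to(g_n\dots g_2,g_1\cdot x)$ whenever $g_1\cdot x$ is defined, and $(w_1,x)\to(w_2,x)$ whenever $w_1\to w_2$ in $G^*$; normality and normal forms are defined as before. The partial action is confluent if $M$ has a confluent presentation $\langle G\mid R\rangle$ such that every element of $G^*\times X$ has a unique normal form and, whenever $(g_n\dots g_1)\cdot x=y$ holds in $X$ (with $g_i\in G$), $(g_n\dots g_1,x)$ can be transformed into $((),y)$ by finitely many one-step reductions, where $()$ is the empty word. For $u\in M$ with normal form $g_k\dots g_1$, $k\ge 0$: "$u\cdot x$ is normal" means $(g_k\dots g_1,x)$ is normal in $G^*\times X$; $u$ is a $C$-element if $\operatorname{dom}(g_i)$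 is compact for $i=1,\dots,k$. The partial action is compact if $\operatorname{dom}(g)$ is compact for every generator $g\in G$, equivalently if every $u\in M$ is a $C$-element.
   Formalization: Both parts additionally assume that some path from a to b exists; without it the claim fails (M={1,g}, gg=g, X a point, dom(g) empty: no path joins [1,x] to [g,x]), and any geodesic is itself a path. *)

theory Defs
  imports "HOL-Analysis.Abstract_Topology" "HOL-Library.Extended_Nonnegative_Real"
begin

section \<open>Weak pseudometrics\<close>

definition weak_pseudometric :: "('x \<Rightarrow> 'x \<Rightarrow> ennreal) \<Rightarrow> bool" where
  "weak_pseudometric d \<longleftrightarrow>
     (\<forall>x. d x x = 0) \<and> (\<forall>x y. d x y = d y x) \<and> (\<forall>x y z. d x z \<le> d x y + d y z)"

definition wpm_topology :: "('x \<Rightarrow> 'x \<Rightarrow> ennreal) \<Rightarrow> 'x topology" where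
  "wpm_topology d = topology (\<lambda>U. \<forall>x\<in>U. \<exists>e>0. \<forall>y. d x y < e \<longrightarrow> y \<in> U)"

lemma openin_wpm_topology:
  "openin (wpm_topology d) U \<longleftrightarrow> (\<forall>x\<in>U. \<exists>e>0. \<forall>y. d x y < e \<longrightarrow> y \<in> U)"
proof -
  have "istopology (\<lambda>U. \<forall>x\<in>U. \<exists>e>0. \<forall>y. d x y < e \<longrightarrow> y \<in> U)"
    unfolding istopology_def
  proof (intro conjI allI impI ballI)
    fix S T x
    assume S: "\<forall>x\<in>S. \<exists>e>0. \<forall>y. d x y < e \<longrightarrow> y \<in> S"
      and T: "\<forall>x\<in>T. \<exists>e>0. \<forall>y. d x y < e \<longrightarrow> y \<in> T" and x: "x \<in> S \<inter> T"
    obtain e1 where e1: "e1 > 0" "\<forall>y. d x y < e1 \<longrightarrow> y \<in> S" using S x by blast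
    obtain e2 where e2: "e2 > 0" "\<forall>y. d x y < e2 \<longrightarrow> y \<in> T" using T x by blast
    show "\<exists>e>0. \<forall>y. d x y < e \<longrightarrow> y \<in> S \<inter> T"
      using e1 e2 by (intro exI[of _ "min e1 e2"]) auto
  next
    fix K x
    assume K: "\<forall>S\<in>K. \<forall>x\<in>S. \<exists>e>0. \<forall>y. d x y < e \<longrightarrow> y \<in> S" and x: "x \<in> \<Union> K"
    obtain S where S: "S \<in> K" "x \<in> S" using x by blast
    obtain e where "e > 0" "\<forall>y. d x y < e \<longrightarrow> y \<in> S" using K S by blast
    then show "\<exists>e>0. \<forall>y. d x y < e \<longrightarrow> y \<in> \<Union> K" using S(1) by blast
  qed
  then show ?thesis by (simp add: wpm_topology_def topology_inverse')
qed

section \<open>Partial actions and their globalization\<close>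

text \<open>A partial map is an option-valued function, so that equality of options expresses
  both ``one side is defined iff the other one is'' and equality of the values.\<close>

definition partial_action :: "('m::monoid_mult \<Rightarrow> 'x \<Rightarrow> 'x option) \<Rightarrow> bool" where
  "partial_action \<alpha> \<longleftrightarrow>
     (\<forall>x. \<alpha> 1 x = Some x) \<and>
     (\<forall>u v x y. \<alpha> v x = Some y \<longrightarrow> \<alpha> (u * v) x = \<alpha> u y)"

definition act_dom :: "('m \<Rightarrow> 'x \<Rightarrow> 'x option) \<Rightarrow> 'm \<Rightarrow> 'x set" where
  "act_dom \<alpha> u = {x. \<alpha> u x \<noteq> None}"

definition non_expansive ::
    "('x \<Rightarrow> 'x \<Rightarrow> ennreal) \<Rightarrow> ('m \<Rightarrow> 'x \<Rightarrow> 'x option) \<Rightarrow> bool" where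
  "non_expansive d \<alpha> \<longleftrightarrow>
     (\<forall>u. \<forall>x\<in>act_dom \<alpha> u. \<forall>y\<in>act_dom \<alpha> u. d (the (\<alpha> u x)) (the (\<alpha> u y)) \<le> d x y)"

definition glob_step ::
    "('m::monoid_mult \<Rightarrow> 'x \<Rightarrow> 'x option) \<Rightarrow> 'm \<times> 'x \<Rightarrow> 'm \<times> 'x \<Rightarrow> bool" where
  "glob_step \<alpha> p q \<longleftrightarrow> (\<exists>u v x y. \<alpha> v x = Some y \<and> p = (u * v, x) \<and> q = (u, y))"

definition glob_class ::
    "('m::monoid_mult \<Rightarrow> 'x \<Rightarrow> 'x option) \<Rightarrow> 'm \<Rightarrow> 'x \<Rightarrow> ('m \<times> 'x) set" where
  "glob_class \<alpha> u x = {q. equivclp (glob_step \<alpha>) (u, x) q}"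

definition glob_carrier :: "('m::monoid_mult \<Rightarrow> 'x \<Rightarrow> 'x option) \<Rightarrow> ('m \<times> 'x) set set" where
  "glob_carrier \<alpha> = UNIV // {(p, q). equivclp (glob_step \<alpha>) p q}"

definition glob_act ::
    "('m::monoid_mult \<Rightarrow> 'x \<Rightarrow> 'x option) \<Rightarrow> 'm \<Rightarrow> ('m \<times> 'x) set \<Rightarrow> ('m \<times> 'x) set" where
  "glob_act \<alpha> u a = (\<Union>(v, x)\<in>a. glob_class \<alpha> (u * v) x)"

definition is_path ::
    "('m::monoid_mult \<Rightarrow> 'x \<Rightarrow> 'x option) \<Rightarrow> ('m \<times> 'x \<times> 'x) list
      \<Rightarrow> ('m \<times> 'x) set \<Rightarrow> ('m \<times> 'x) set \<Rightarrow> bool" where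
  "is_path \<alpha> \<pi> a b \<longleftrightarrow>
     (let source = (\<lambda>(u, x, y). glob_class \<alpha> u x); target = (\<lambda>(u, x, y). glob_class \<alpha> u y)
      in \<pi> \<noteq> [] \<and> source (hd \<pi>) = a \<and>
         (\<forall>j. Suc j < length \<pi> \<longrightarrow> target (\<pi> ! j) = source (\<pi> ! Suc j)) \<and>
         target (last \<pi>) = b)"

definition path_length ::
    "('x \<Rightarrow> 'x \<Rightarrow> ennreal) \<Rightarrow> ('m \<times> 'x \<times> 'x) list \<Rightarrow> ennreal" where
  "path_length d \<pi> = (\<Sum>(u, x, y)\<leftarrow>\<pi>. d x y)"

text \<open>The infimum of the empty set in \<^typ>\<open>ennreal\<close> is \<open>\<infinity>\<close>, so points not joined by a
  path have infinite distance. A geodesic is itself a path, so there is none between such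
  points; points at infinite distance that are joined by some path do have a geodesic.\<close>

definition glob_dist ::
    "('x \<Rightarrow> 'x \<Rightarrow> ennreal) \<Rightarrow> ('m::monoid_mult \<Rightarrow> 'x \<Rightarrow> 'x option)
      \<Rightarrow> ('m \<times> 'x) set \<Rightarrow> ('m \<times> 'x) set \<Rightarrow> ennreal" where
  "glob_dist d \<alpha> a b = (INF \<pi>\<in>{\<pi>. is_path \<alpha> \<pi> a b}. path_length d \<pi>)"

definition geodesic ::
    "('x \<Rightarrow> 'x \<Rightarrow> ennreal) \<Rightarrow> ('m::monoid_mult \<Rightarrow> 'x \<Rightarrow> 'x option)
      \<Rightarrow> ('m \<times> 'x \<times> 'x) list \<Rightarrow> ('m \<times> 'x) set \<Rightarrow> ('m \<times> 'x) set \<Rightarrow> bool" where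
  "geodesic d \<alpha> \<pi> a b \<longleftrightarrow> is_path \<alpha> \<pi> a b \<and> path_length d \<pi> = glob_dist d \<alpha> a b"

section \<open>Confluence\<close>

definition is_normal :: "('a \<Rightarrow> 'a \<Rightarrow> bool) \<Rightarrow> 'a \<Rightarrow> bool" where
  "is_normal r a \<longleftrightarrow> (\<nexists>b. r a b)"

definition is_normal_form :: "('a \<Rightarrow> 'a \<Rightarrow> bool) \<Rightarrow> 'a \<Rightarrow> 'a \<Rightarrow> bool" where
  "is_normal_form r a n \<longleftrightarrow> is_normal r n \<and> equivclp r a n"

text \<open>The word \<open>g\<^sub>n \<dots> g\<^sub>1\<close> is the list \<open>[g\<^sub>n, \<dots>, g\<^sub>1]\<close>, so the letter acting first is the
  last one of the list. Both kinds of one-step reduction are relations on words over \<open>G\<close>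
  only, i.e. on \<open>lists G\<close>.\<close>

definition word_step ::
    "'g set \<Rightarrow> ('g list \<times> 'g list) set \<Rightarrow> 'g list \<Rightarrow> 'g list \<Rightarrow> bool" where
  "word_step G R w w' \<longleftrightarrow>
     (\<exists>w1 w2 l r. w1 \<in> lists G \<and> w2 \<in> lists G \<and> (l, r) \<in> R \<and>
        w = w1 @ l @ w2 \<and> w' = w1 @ r @ w2)"

definition word_val :: "('g \<Rightarrow> 'm::monoid_mult) \<Rightarrow> 'g list \<Rightarrow> 'm" where
  "word_val \<iota> w = prod_list (map \<iota> w)"

text \<open>The monoid \<^typ>\<open>'m\<close> is presented by \<open>\<langle>G | R\<rangle>\<close> via the assignment \<open>\<iota>\<close> of elements to
  letters if \<open>\<iota>\<close> induces an isomorphism from \<open>lists G\<close> modulo reduction equivalence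
  onto \<^typ>\<open>'m\<close>: the induced homomorphism is onto, and its kernel is that equivalence.\<close>

definition presents ::
    "'g set \<Rightarrow> ('g list \<times> 'g list) set \<Rightarrow> ('g \<Rightarrow> 'm::monoid_mult) \<Rightarrow> bool" where
  "presents G R \<iota> \<longleftrightarrow>
     R \<subseteq> lists G \<times> lists G \<and>
     word_val \<iota> ` lists G = UNIV \<and>
     (\<forall>w\<in>lists G. \<forall>w'\<in>lists G.
        word_val \<iota> w = word_val \<iota> w' \<longleftrightarrow> equivclp (word_step G R) w w')"

definition confluent_presentation :: "'g set \<Rightarrow> ('g list \<times> 'g list) set \<Rightarrow> bool" where
  "confluent_presentation G R \<longleftrightarrow>
     (\<nexists>f :: nat \<Rightarrow> 'g list. \<forall>i. word_step G R (f i) (f (Suc i))) \<and>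
     (\<forall>w\<in>lists G. \<exists>!n. is_normal_form (word_step G R) w n) \<and>
     (\<forall>(l, r)\<in>R. length l \<noteq> 1)"

definition pair_step ::
    "'g set \<Rightarrow> ('g list \<times> 'g list) set \<Rightarrow> ('g \<Rightarrow> 'm) \<Rightarrow> ('m \<Rightarrow> 'x \<Rightarrow> 'x option)
      \<Rightarrow> 'g list \<times> 'x \<Rightarrow> 'g list \<times> 'x \<Rightarrow> bool" where
  "pair_step G R \<iota> \<alpha> p q \<longleftrightarrow>
     (\<exists>w g x y. w \<in> lists G \<and> g \<in> G \<and> \<alpha> (\<iota> g) x = Some y \<and> p = (w @ [g], x) \<and> q = (w, y)) \<or>
     (\<exists>w1 w2 x. word_step G R w1 w2 \<and> p = (w1, x) \<and> q = (w2, x))"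

definition confluent_action ::
    "'g set \<Rightarrow> ('g list \<times> 'g list) set \<Rightarrow> ('g \<Rightarrow> 'm::monoid_mult)
      \<Rightarrow> ('m \<Rightarrow> 'x \<Rightarrow> 'x option) \<Rightarrow> bool" where
  "confluent_action G R \<iota> \<alpha> \<longleftrightarrow>
     presents G R \<iota> \<and> confluent_presentation G R \<and>
     (\<forall>w\<in>lists G. \<forall>x. \<exists>!n. is_normal_form (pair_step G R \<iota> \<alpha>) (w, x) n) \<and>
     (\<forall>w\<in>lists G. \<forall>x y. \<alpha> (word_val \<iota> w) x = Some y \<longrightarrow>
        (pair_step G R \<iota> \<alpha>)\<^sup>*\<^sup>* (w, x) ([], y))"

definition normal_word ::
    "'g set \<Rightarrow> ('g list \<times> 'g list) set \<Rightarrow> ('g \<Rightarrow> 'm::monoid_mult) \<Rightarrow> 'm \<Rightarrow> 'g list" where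
  "normal_word G R \<iota> u =
     (THE w. w \<in> lists G \<and> word_val \<iota> w = u \<and> is_normal (word_step G R) w)"

lemma equivclp_word_step_lists:
  assumes "R \<subseteq> lists G \<times> lists G" "equivclp (word_step G R) w w'" "w \<in> lists G"
  shows "w' \<in> lists G"
  using assms(2,3)
proof (induction rule: equivclp_induct)
  case (step y z)
  have "word_step G R a b \<Longrightarrow> a \<in> lists G \<and> b \<in> lists G" for a b
    using assms(1) unfolding word_step_def by (fastforce simp: subset_iff)
  then show ?case using step.hyps by blast
qed

text \<open>Hence \<^const>\<open>normal_word\<close> is well defined.\<close>

lemma ex1_normal_word:
  assumes "presents G R \<iota>" "confluent_presentation G R"
  shows "\<exists>!w. w \<in> lists G \<and> word_val \<iota> w = u \<and> is_normal (word_step G R) w"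
proof -
  have R: "R \<subseteq> lists G \<times> lists G" and "u \<in> word_val \<iota> ` lists G"
    and ker: "\<And>w w'. w \<in> lists G \<Longrightarrow> w' \<in> lists G \<Longrightarrow>
        word_val \<iota> w = word_val \<iota> w' \<longleftrightarrow> equivclp (word_step G R) w w'"
    using assms(1) unfolding presents_def by auto
  then obtain v where v: "v \<in> lists G" "word_val \<iota> v = u" by auto
  have "\<exists>!n. is_normal_form (word_step G R) v n"
    using assms(2) v(1) unfolding confluent_presentation_def by blast
  moreover have "is_normal_form (word_step G R) v n \<longleftrightarrow>
      n \<in> lists G \<and> word_val \<iota> n = u \<and> is_normal (word_step G R) n" for n
    unfolding is_normal_form_def
    using ker[OF v(1), of n] v equivclp_word_step_lists[OF R _ v(1), of n] by metis
  ultimately show ?thesis by simp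
qed

definition normal_at ::
    "'g set \<Rightarrow> ('g list \<times> 'g list) set \<Rightarrow> ('g \<Rightarrow> 'm::monoid_mult)
      \<Rightarrow> ('m \<Rightarrow> 'x \<Rightarrow> 'x option) \<Rightarrow> 'm \<Rightarrow> 'x \<Rightarrow> bool" where
  "normal_at G R \<iota> \<alpha> u x \<longleftrightarrow> is_normal (pair_step G R \<iota> \<alpha>) (normal_word G R \<iota> u, x)"

definition C_element ::
    "'g set \<Rightarrow> ('g list \<times> 'g list) set \<Rightarrow> ('g \<Rightarrow> 'm::monoid_mult)
      \<Rightarrow> ('x \<Rightarrow> 'x \<Rightarrow> ennreal) \<Rightarrow> ('m \<Rightarrow> 'x \<Rightarrow> 'x option) \<Rightarrow> 'm \<Rightarrow> bool" where
  "C_element G R \<iota> d \<alpha> u \<longleftrightarrow>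
     (\<forall>g\<in>set (normal_word G R \<iota> u). compactin (wpm_topology d) (act_dom \<alpha> (\<iota> g)))"

definition compact_action ::
    "'g set \<Rightarrow> ('g \<Rightarrow> 'm) \<Rightarrow> ('x \<Rightarrow> 'x \<Rightarrow> ennreal) \<Rightarrow> ('m \<Rightarrow> 'x \<Rightarrow> 'x option) \<Rightarrow> bool" where
  "compact_action G \<iota> d \<alpha> \<longleftrightarrow> (\<forall>g\<in>G. compactin (wpm_topology d) (act_dom \<alpha> (\<iota> g)))"

end

theory Submission imports Defs begin

text \<open>Write words with the letter acting first in front. Consider the paths that descend from
  $[u,x]$ by stripping letters off the normal word of \<open>u\<close>, one at a time, and then ascend to $[v,y]$
  along the normal word of \<open>v\<close>; let \<open>\<delta>\<close> be the infimum of their lengths. By non-expansiveness \<open>\<delta>\<close>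
  does not change when a letter of \<open>v\<close> is applied to a point of its domain, hence, by uniqueness of
  normal forms, \<open>\<delta>\<close> depends only on the class $[v,y]$. Being 1-Lipschitz in \<open>y\<close> and zero at $[u,x]$, it
  is a lower bound for the length of every path. On the other hand \<open>\<delta>\<close> is built from finitely many
  successive infima of Lipschitz functions over domains of letters, which are attained if these domains
  are compact; so a path of length \<open>\<delta>\<close> exists.\<close>

section \<open>Minima of Lipschitz functions on compact sets\<close>

lemma wpm_sym: "weak_pseudometric d \<Longrightarrow> d x y = d y x"
  and wpm_refl: "weak_pseudometric d \<Longrightarrow> d x x = 0"
  and wpm_triangle: "weak_pseudometric d \<Longrightarrow> d x z \<le> d x y + d y z"
  unfolding weak_pseudometric_def by blast+

lemma openin_wpm_ball:
  assumes "weak_pseudometric d"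
  shows "openin (wpm_topology d) {y. d x y < e}"
  unfolding openin_wpm_topology
proof
  fix y assume "y \<in> {y. d x y < e}"
  then have less: "d x y < e" by simp
  show "\<exists>e'>0. \<forall>z. d y z < e' \<longrightarrow> z \<in> {y. d x y < e}"
  proof (intro exI[of _ "e - d x y"] conjI allI impI CollectI)
    show "0 < e - d x y" using less by (simp add: diff_gr0_ennreal)
    fix z assume "d y z < e - d x y"
    then have "d x y + d y z < e"
      using less
      by (metis add.commute less_diff_eq_ennreal less_top order_le_less_trans order_less_imp_le top_greatest)
    then show "d x z < e" using wpm_triangle[OF assms] by (metis le_less_trans)
  qed
qed

text \<open>Suppose that no point attains the infimum. By the Lipschitz bound, \<open>h\<close>
  stays above some \<open>c s\<close> exceeding the infimum on a ball around each \<open>s\<close>.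
  Finitely many of these balls cover \<open>K\<close>, so the least of their \<open>c s\<close> is a
  lower bound that is too large. The factor two fits the later functions, which are sums of two
  terms that each vary by at most \<open>d s t\<close>.\<close>

lemma compactin_INF_attained:
  fixes h :: "'x \<Rightarrow> ennreal"
  assumes d: "weak_pseudometric d"
    and K: "compactin (wpm_topology d) K"
    and lip: "\<And>s t. s \<in> K \<Longrightarrow> t \<in> K \<Longrightarrow> h s \<le> h t + (d s t + d s t)"
    and fin: "(INF s\<in>K. h s) < top"
  shows "\<exists>s\<in>K. h s = (INF s\<in>K. h s)"
proof (rule ccontr)
  let ?m = "INF s\<in>K. h s"
  assume "\<not> ?thesis"
  then have less: "?m < h s" if "s \<in> K" for s
    using that INF_lower[of s K h] by (auto simp: order_le_less)
  have "\<exists>c e. ?m < c \<and> 0 < e \<and> (\<forall>t\<in>K. d s t < e \<longrightarrow> c \<le> h t)" if s: "s \<in> K" for s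
  proof -
    obtain c c' where c: "?m < c" "c < c'" "c' < h s" using less[OF s] dense by metis
    \<comment> \<open>Half the gap, so that the loss \<open>d s t + d s t\<close> on the ball does
      not exceed \<open>c' - c\<close>.\<close>
    define e where "e = (c' - c) / 2"
    have "e + e = (c' - c) * 2 / 2"
      by (simp only: e_def mult_2_right add_divide_distrib_ennreal)
    also have "\<dots> = c' - c" by (rule mult_divide_eq_ennreal) simp_all
    finally have e: "e + e = c' - c" "0 < e"
      using c(2) by (simp_all add: e_def diff_gr0_ennreal ennreal_zero_less_divide)
    have "c \<le> h t" if t: "t \<in> K" "d s t < e" for t
    proof (rule ccontr)
      assume "\<not> c \<le> h t"
      then have "h t + (d s t + d s t) \<le> c + (e + e)" using t by (intro add_mono) auto
      also have "\<dots> = c'" using c by (simp add: e(1) add_diff_inverse_ennreal)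
      finally show False using lip[OF s t(1)] c(3) by simp
    qed
    then show ?thesis using c e by blast
  qed
  then obtain c e where ce: "\<And>s. s \<in> K \<Longrightarrow> ?m < c s" "\<And>s. s \<in> K \<Longrightarrow> 0 < e s"
    "\<And>s t. s \<in> K \<Longrightarrow> t \<in> K \<Longrightarrow> d s t < e s \<Longrightarrow> c s \<le> h t"
    by metis
  let ?B = "\<lambda>s. {t. d s t < e s}"
  have "\<exists>\<F>. finite \<F> \<and> \<F> \<subseteq> ?B ` K \<and> K \<subseteq> \<Union> \<F>"
  proof (rule compactinD[OF K])
    show "openin (wpm_topology d) U" if "U \<in> ?B ` K" for U
      using that openin_wpm_ball[OF d] by blast
    show "K \<subseteq> \<Union> (?B ` K)" using ce(2) wpm_refl[OF d] by auto
  qed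
  then obtain \<F> where \<F>: "finite \<F>" "\<F> \<subseteq> ?B ` K" "K \<subseteq> \<Union> \<F>" by blast
  obtain F where F: "finite F" "F \<subseteq> K" "K \<subseteq> \<Union> (?B ` F)"
    using finite_subset_image[OF \<F>(1,2)] \<F>(3) by blast
  \<comment> \<open>An empty \<open>F\<close> would make \<open>K\<close> empty, and the infimum
    would be \<open>top\<close>, against \<open>fin\<close>.\<close>
  have "F \<noteq> {}" using F(3) fin by auto
  have "Min (c ` F) \<le> h t" if t: "t \<in> K" for t
  proof -
    obtain s where "s \<in> F" "d s t < e s" using F(3) t by auto
    then have "Min (c ` F) \<le> c s" "c s \<le> h t" using ce(3) F(1,2) t by auto
    then show ?thesis by (rule order_trans)
  qed
  then have "Min (c ` F) \<le> ?m" by (simp add: INF_greatest)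
  moreover have "?m < Min (c ` F)"
    using F(1,2) ce(1) \<open>F \<noteq> {}\<close> by (subst Min_gr_iff) auto
  ultimately show False by simp
qed

section \<open>The zigzag distance of two words\<close>

text \<open>\<open>A g\<close> is the partial action of the letter \<open>g\<close>; in \<open>U\<close> and \<open>V\<close> the head is the letter acting
  first, so these are the reverses of the words used elsewhere.\<close>

fun zigzag ::
    "('x \<Rightarrow> 'x \<Rightarrow> ennreal) \<Rightarrow> ('g \<Rightarrow> 'x \<Rightarrow> 'x option)
      \<Rightarrow> 'g list \<Rightarrow> 'x \<Rightarrow> 'g list \<Rightarrow> 'x \<Rightarrow> ennreal" where
  "zigzag d A U x V y =
     min (if U = V then d x y else top)
       (min (case U of [] \<Rightarrow> top
             | g # U' \<Rightarrow> (INF s\<in>act_dom A g. d x s + zigzag d A U' (the (A g s)) V y))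
            (case V of [] \<Rightarrow> top
             | h # V' \<Rightarrow> (INF t\<in>act_dom A h. zigzag d A U x V' (the (A h t)) + d t y)))"

text \<open>The left side matches arbitrary words, so as a simp rule the equation would unfold its
  own right side forever.\<close>

declare zigzag.simps[simp del]

lemma zigzag_eq_le: "zigzag d A U x U y \<le> d x y"
  by (subst zigzag.simps) simp

lemma zigzag_left_le:
  "A g s = Some s' \<Longrightarrow> zigzag d A (g # U) x V y \<le> d x s + zigzag d A U s' V y"
  by (subst zigzag.simps) (auto simp: act_dom_def min_le_iff_disj intro!: INF_lower2[of s])

lemma zigzag_right_le:
  "A h t = Some t' \<Longrightarrow> zigzag d A U x (h # V) y \<le> zigzag d A U x V t' + d t y"
  by (subst zigzag.simps) (auto simp: act_dom_def min_le_iff_disj intro!: INF_lower2[of t])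

lemma zigzag_greatest:
  assumes "U = V \<Longrightarrow> c \<le> d x y"
    and "\<And>g U' s s'. U = g # U' \<Longrightarrow> A g s = Some s' \<Longrightarrow> c \<le> d x s + zigzag d A U' s' V y"
    and "\<And>h V' t t'. V = h # V' \<Longrightarrow> A h t = Some t' \<Longrightarrow> c \<le> zigzag d A U x V' t' + d t y"
  shows "c \<le> zigzag d A U x V y"
  using assms
  by (subst zigzag.simps) (auto simp: act_dom_def le_INF_iff split: list.splits)

text \<open>Moving \<open>e\<close> to the left reduces this to \<open>zigzag_greatest\<close>.
  Since subtraction in \<open>ennreal\<close> does not undo the addition of \<open>top\<close>, the
  trivial case of infinite \<open>e\<close> is split off.\<close>

lemma zigzag_add_greatest:
  assumes eq: "U = V \<Longrightarrow> c \<le> d x y + e"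
    and left: "\<And>g U' s s'. U = g # U' \<Longrightarrow> A g s = Some s' \<Longrightarrow> c \<le> d x s + zigzag d A U' s' V y + e"
    and right: "\<And>h V' t t'. V = h # V' \<Longrightarrow> A h t = Some t' \<Longrightarrow> c \<le> zigzag d A U x V' t' + d t y + e"
  shows "c \<le> zigzag d A U x V y + e"
proof (cases "e = top")
  case False
  then have iff: "c - e \<le> b \<longleftrightarrow> c \<le> b + e" for b
    by (simp add: ennreal_minus_le_iff add.commute)
  show ?thesis
    unfolding iff[symmetric] by (rule zigzag_greatest; unfold iff; fact assms)
qed simp

text \<open>Finiteness rules out that the minimum is one of the default values \<open>top\<close>,
  so it comes from an actual branch of the recursion.\<close>

lemma zigzag_attained_cases:
  assumes "zigzag d A U x V y < top"
  obtains (eq) "U = V" "zigzag d A U x V y = d x y"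
    | (left) g U' where "U = g # U'"
        "zigzag d A U x V y = (INF s\<in>act_dom A g. d x s + zigzag d A U' (the (A g s)) V y)"
    | (right) h V' where "V = h # V'"
        "zigzag d A U x V y = (INF t\<in>act_dom A h. zigzag d A U x V' (the (A h t)) + d t y)"
proof -
  define P where "P = (if U = V then d x y else top)"
  define Q where "Q = (case U of [] \<Rightarrow> top
    | g # U' \<Rightarrow> (INF s\<in>act_dom A g. d x s + zigzag d A U' (the (A g s)) V y))"
  define S where "S = (case V of [] \<Rightarrow> top
    | h # V' \<Rightarrow> (INF t\<in>act_dom A h. zigzag d A U x V' (the (A h t)) + d t y))"
  have "zigzag d A U x V y = min P (min Q S)"
    unfolding P_def Q_def S_def by (rule zigzag.simps)
  then consider "zigzag d A U x V y = P" | "zigzag d A U x V y = Q" | "zigzag d A U x V y = S"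
    unfolding min_def by presburger
  then show thesis
  proof cases
    case 1
    then show thesis using assms eq unfolding P_def by (cases "U = V") auto
  next
    case 2
    then show thesis using assms left unfolding Q_def by (cases U) auto
  next
    case 3
    then show thesis using assms right unfolding S_def by (cases V) auto
  qed
qed

lemma zigzag_refl:
  "weak_pseudometric d \<Longrightarrow> zigzag d A U x U x = 0"
  using zigzag_eq_le[of d A U x x] by (simp add: wpm_refl)

text \<open>The point \<open>y\<close> enters directly only through \<open>d x y\<close> and
  \<open>d t y\<close>, where the triangle inequality suffices; the left branch keeps
  \<open>y\<close> and shortens \<open>U\<close>, so induction applies.\<close>

lemma zigzag_lipschitz_right:
  assumes d: "weak_pseudometric d"
  shows "zigzag d A U x V y \<le> zigzag d A U x V y' + d y' y"
proof (induction "length U + length V" arbitrary: U V x y y' rule: less_induct)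
  case less
  show ?case
  proof (rule zigzag_add_greatest)
    assume "U = V"
    then show "zigzag d A U x V y \<le> d x y' + d y' y"
      using zigzag_eq_le[of d A U x y] wpm_triangle[OF d, of x y y'] by simp
  next
    fix g U' s s' assume *: "U = g # U'" "A g s = Some s'"
    have "zigzag d A U x V y \<le> d x s + zigzag d A U' s' V y"
      unfolding * by (rule zigzag_left_le[where A=A, OF *(2)])
    also have "\<dots> \<le> d x s + (zigzag d A U' s' V y' + d y' y)"
      using * by (intro add_left_mono less) simp
    finally show "zigzag d A U x V y \<le> d x s + zigzag d A U' s' V y' + d y' y"
      by (simp add: add.assoc)
  next
    fix h V' t t' assume *: "V = h # V'" "A h t = Some t'"
    have "zigzag d A U x V y \<le> zigzag d A U x V' t' + d t y"
      unfolding * by (rule zigzag_right_le[where A=A, OF *(2)])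
    also have "\<dots> \<le> zigzag d A U x V' t' + (d t y' + d y' y)"
      by (intro add_left_mono wpm_triangle d)
    finally show "zigzag d A U x V y \<le> zigzag d A U x V' t' + d t y' + d y' y"
      by (simp add: add.assoc)
  qed
qed

lemma zigzag_lipschitz_left:
  assumes d: "weak_pseudometric d"
  shows "zigzag d A U x V y \<le> d x x' + zigzag d A U x' V y"
proof (induction "length U + length V" arbitrary: U V x x' y rule: less_induct)
  case less
  have "zigzag d A U x V y \<le> zigzag d A U x' V y + d x x'"
  proof (rule zigzag_add_greatest)
    assume "U = V"
    then show "zigzag d A U x V y \<le> d x' y + d x x'"
      using zigzag_eq_le[of d A U x y] wpm_triangle[OF d, of x y x'] by (simp add: add.commute)
  next
    fix g U' s s' assume *: "U = g # U'" "A g s = Some s'"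
    have "zigzag d A U x V y \<le> d x s + zigzag d A U' s' V y"
      unfolding * by (rule zigzag_left_le[where A=A, OF *(2)])
    also have "\<dots> \<le> (d x x' + d x' s) + zigzag d A U' s' V y"
      by (intro add_right_mono wpm_triangle d)
    finally show "zigzag d A U x V y \<le> d x' s + zigzag d A U' s' V y + d x x'"
      by (simp add: ac_simps)
  next
    fix h V' t t' assume *: "V = h # V'" "A h t = Some t'"
    have "zigzag d A U x V y \<le> zigzag d A U x V' t' + d t y"
      unfolding * by (rule zigzag_right_le[where A=A, OF *(2)])
    also have "\<dots> \<le> (d x x' + zigzag d A U x' V' t') + d t y"
      using * by (intro add_right_mono less) simp
    finally show "zigzag d A U x V y \<le> zigzag d A U x' V' t' + d t y + d x x'"
      by (simp add: ac_simps)
  qed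
  then show ?case by (simp add: add.commute)
qed

lemma non_expansiveD:
  assumes "non_expansive d A" "A g s = Some s'" "A g t = Some t'"
  shows "d s' t' \<le> d s t"
  using assms unfolding non_expansive_def act_dom_def by force

text \<open>Applying a defined letter does not change the class in the globalization, and this is
  the matching invariance of \<open>zigzag\<close>. One inequality strips \<open>h\<close> at
  \<open>y\<close> itself, at no cost. For the other, \<open>V\<close> stays fixed and the induction
  runs over \<open>U\<close> alone.\<close>

lemma zigzag_apply_right:
  assumes d: "weak_pseudometric d"
    and ne: "non_expansive d A"
    and y: "A h y = Some y'"
  shows "zigzag d A U x (h # V) y = zigzag d A U x V y'"
proof (rule antisym)
  show "zigzag d A U x (h # V) y \<le> zigzag d A U x V y'"
    using zigzag_right_le[where A=A and d=d and U=U and x=x and V=V and y=y, OF y] by (simp add: wpm_refl[OF d])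
  show "zigzag d A U x V y' \<le> zigzag d A U x (h # V) y"
  proof (induction U arbitrary: x rule: measure_induct_rule[of length])
    case (less U)
    show ?case
    proof (rule zigzag_greatest)
      \<comment> \<open>Stripping \<open>h\<close> off \<open>U\<close> at the point
        \<open>y\<close> costs \<open>d x y\<close> and leaves \<open>V\<close> with
        \<open>y'\<close> on both sides, at distance zero.\<close>
      assume U: "U = h # V"
      show "zigzag d A U x V y' \<le> d x y"
        using zigzag_left_le[where A = A and U = V and V = V and y = y', OF y, of d x]
        by (simp add: U zigzag_refl[OF d])
    next
      fix g U' s s' assume *: "U = g # U'" "A g s = Some s'"
      have "zigzag d A U x V y' \<le> d x s + zigzag d A U' s' V y'"
        unfolding * by (rule zigzag_left_le[where A=A, OF *(2)])
      also have "\<dots> \<le> d x s + zigzag d A U' s' (h # V) y"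
        using * by (intro add_left_mono less) simp
      finally show "zigzag d A U x V y' \<le> d x s + zigzag d A U' s' (h # V) y" .
    next
      \<comment> \<open>Here \<open>h\<close> is stripped at some other point \<open>t\<close>;
        moving the endpoint from \<open>t'\<close> to \<open>y'\<close> costs at most
        \<open>d t' y'\<close>, which non-expansiveness bounds by \<open>d t y\<close>.\<close>
      fix h' V' t t' assume "h # V = h' # V'" "A h' t = Some t'"
      then have *: "A h t = Some t'" "V' = V" by simp_all
      have "zigzag d A U x V y' \<le> zigzag d A U x V t' + d t' y'"
        by (rule zigzag_lipschitz_right[OF d])
      also have "\<dots> \<le> zigzag d A U x V t' + d t y"
        by (intro add_left_mono non_expansiveD[OF ne *(1) y])
      finally show "zigzag d A U x V y' \<le> zigzag d A U x V' t' + d t y"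
        by (simp only: *(2))
    qed
  qed
qed

section \<open>Paths\<close>

lemma is_path_Cons:
  "is_path \<alpha> ((u, s, t) # \<pi>) a b \<longleftrightarrow>
     glob_class \<alpha> u s = a \<and>
     (if \<pi> = [] then glob_class \<alpha> u t = b else is_path \<alpha> \<pi> (glob_class \<alpha> u t) b)"
proof (cases \<pi>)
  case (Cons p \<pi>')
  have "(\<forall>j. Suc j < length ((u, s, t) # \<pi>) \<longrightarrow> P (((u, s, t) # \<pi>) ! j) (((u, s, t) # \<pi>) ! Suc j))
      \<longleftrightarrow> P (u, s, t) (hd \<pi>) \<and> (\<forall>j. Suc j < length \<pi> \<longrightarrow> P (\<pi> ! j) (\<pi> ! Suc j))" for P
    unfolding Cons by (auto simp: less_Suc_eq_0_disj nth_Cons split: nat.splits)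
  from this[of "\<lambda>(u, x, y) (u', x', y'). glob_class \<alpha> u y = glob_class \<alpha> u' x'"]
  show ?thesis
    unfolding is_path_def by (auto simp: Cons split_beta)
qed (simp add: is_path_def)

lemma is_path_snoc:
  "is_path \<alpha> \<pi> a (glob_class \<alpha> u s) \<Longrightarrow>
     is_path \<alpha> (\<pi> @ [(u, s, t)]) a (glob_class \<alpha> u t)"
proof (induction \<pi> arbitrary: a)
  case Nil
  then show ?case by (simp add: is_path_def)
next
  case (Cons p \<pi>)
  then show ?case by (cases p) (auto simp: is_path_Cons split: if_splits)
qed

lemma path_length_simps [simp]:
  "path_length d [] = 0"
  "path_length d ((u, x, y) # \<pi>) = d x y + path_length d \<pi>"
  "path_length d (\<pi> @ \<rho>) = path_length d \<pi> + path_length d \<rho>"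
  by (simp_all add: path_length_def)

lemma glob_class_eq_iff:
  "glob_class \<alpha> u x = glob_class \<alpha> v y \<longleftrightarrow> equivclp (glob_step \<alpha>) (u, x) (v, y)"
  unfolding glob_class_def
  by (auto intro: equivclp_trans dest: equivclp_sym)

lemma glob_class_apply:
  "\<alpha> v x = Some y \<Longrightarrow> glob_class \<alpha> (u * v) x = glob_class \<alpha> u y"
  unfolding glob_class_eq_iff by (rule r_into_equivclp) (auto simp: glob_step_def)

text \<open>Following the branch that realizes the minimum yields one segment of the path per
  stripped letter and a last one where the words agree; compactness provides the points at which
  letters are stripped.\<close>

lemma zigzag_path:
  assumes d: "weak_pseudometric d"
    and ne: "non_expansive d A"
    and A: "A = (\<lambda>g. \<alpha> (\<iota> g))"
    and "zigzag d A U x V y < top"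
    and "\<And>g. g \<in> set U \<union> set V \<Longrightarrow> compactin (wpm_topology d) (act_dom \<alpha> (\<iota> g))"
  shows "\<exists>\<pi>. is_path \<alpha> \<pi> (glob_class \<alpha> (word_val \<iota> (rev U)) x) (glob_class \<alpha> (word_val \<iota> (rev V)) y) \<and>
    path_length d \<pi> = zigzag d A U x V y"
  using assms(4,5)
proof (induction "length U + length V" arbitrary: U V x y rule: less_induct)
  case less
  let ?z = "zigzag d A U x V y"
  have val: "word_val \<iota> (W @ [g]) = word_val \<iota> W * \<iota> g" for g W
    by (simp add: word_val_def)
  have dom: "act_dom A g = act_dom \<alpha> (\<iota> g)" for g by (simp add: A act_dom_def)
  consider (eq) "U = V" "?z = d x y"
    | (left) g U' where "U = g # U'"
        "?z = (INF s\<in>act_dom A g. d x s + zigzag d A U' (the (A g s)) V y)"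
    | (right) h V' where "V = h # V'"
        "?z = (INF t\<in>act_dom A h. zigzag d A U x V' (the (A h t)) + d t y)"
    using zigzag_attained_cases[OF less.prems(1)] .
  then show ?case
  proof cases
    case eq
    then show ?thesis
      by (intro exI[of _ "[(word_val \<iota> (rev U), x, y)]"]) (simp add: is_path_Cons)
  next
    case left
    let ?h = "\<lambda>s. d x s + zigzag d A U' (the (A g s)) V y"
    have "\<exists>s\<in>act_dom A g. ?h s = (INF s\<in>act_dom A g. ?h s)"
    proof (rule compactin_INF_attained[OF d])
      fix s t assume st: "s \<in> act_dom A g" "t \<in> act_dom A g"
      have "d x s \<le> d x t + d s t"
        using wpm_triangle[OF d, of x s t] by (simp add: wpm_sym[OF d])
      moreover have "zigzag d A U' (the (A g s)) V y \<le> d s t + zigzag d A U' (the (A g t)) V y"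
        using ne st unfolding non_expansive_def
        by (blast intro: order_trans[OF zigzag_lipschitz_left[OF d] add_right_mono])
      ultimately have "?h s \<le> (d x t + d s t) + (d s t + zigzag d A U' (the (A g t)) V y)"
        by (rule add_mono)
      then show "?h s \<le> ?h t + (d s t + d s t)" by (simp add: ac_simps)
    qed (use left less.prems in \<open>auto simp: dom\<close>)
    then obtain s s' where s: "A g s = Some s'" "d x s + zigzag d A U' s' V y = ?z"
      unfolding left(2) by (auto simp: act_dom_def)
    have fin: "zigzag d A U' s' V y < top"
      using s(2) less.prems(1) by (metis ennreal_add_eq_top less_top)
    obtain \<pi> where "is_path \<alpha> \<pi> (glob_class \<alpha> (word_val \<iota> (rev U')) s') (glob_class \<alpha> (word_val \<iota> (rev V)) y)"
      "path_length d \<pi> = zigzag d A U' s' V y"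
      using less.hyps[OF _ fin] left(1) less.prems(2) by auto
    moreover have "\<pi> \<noteq> []" using calculation(1) by (auto simp: is_path_def)
    \<comment> \<open>Move from \<open>x\<close> to \<open>s\<close> under the whole word, then
      apply \<open>g\<close>: the pairs with \<open>U\<close>, \<open>s\<close> and with
      \<open>U'\<close>, \<open>s'\<close> have the same class, so the shorter path can
      follow.\<close>
    ultimately show ?thesis
      using glob_class_apply[of \<alpha> "\<iota> g" s s'] s
      by (intro exI[of _ "(word_val \<iota> (rev U), x, s) # \<pi>"]) (simp add: left(1) val is_path_Cons A)
  next
    case right
    let ?h = "\<lambda>t. zigzag d A U x V' (the (A h t)) + d t y"
    have "\<exists>t\<in>act_dom A h. ?h t = (INF t\<in>act_dom A h. ?h t)"
    proof (rule compactin_INF_attained[OF d])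
      fix s t assume st: "s \<in> act_dom A h" "t \<in> act_dom A h"
      have "d s y \<le> d s t + d t y" by (rule wpm_triangle[OF d])
      moreover have "zigzag d A U x V' (the (A h s)) \<le> zigzag d A U x V' (the (A h t)) + d t s"
        using ne st unfolding non_expansive_def
        by (blast intro: order_trans[OF zigzag_lipschitz_right[OF d] add_left_mono])
      ultimately have "?h s \<le> (zigzag d A U x V' (the (A h t)) + d t s) + (d s t + d t y)"
        by (intro add_mono)
      then show "?h s \<le> ?h t + (d s t + d s t)" by (simp add: ac_simps wpm_sym[OF d, of t s])
    qed (use right less.prems in \<open>auto simp: dom\<close>)
    then obtain t t' where t: "A h t = Some t'" "zigzag d A U x V' t' + d t y = ?z"
      unfolding right(2) by (auto simp: act_dom_def)
    have fin: "zigzag d A U x V' t' < top"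
      using t(2) less.prems(1) by (metis ennreal_add_eq_top less_top)
    obtain \<pi> where "is_path \<alpha> \<pi> (glob_class \<alpha> (word_val \<iota> (rev U)) x) (glob_class \<alpha> (word_val \<iota> (rev V')) t')"
      "path_length d \<pi> = zigzag d A U x V' t'"
      using less.hyps[OF _ fin] right(1) less.prems(2) by auto
    \<comment> \<open>Symmetrically, the shorter path ends in the class given by \<open>V'\<close>
      and \<open>t'\<close>, which is that of \<open>V\<close> and \<open>t\<close>, and a segment
      from \<open>t\<close> to \<open>y\<close> is appended.\<close>
    then show ?thesis
      using is_path_snoc[of \<alpha> \<pi> _ "word_val \<iota> (rev V)" t y] glob_class_apply[of \<alpha> "\<iota> h" t t'] t
      by (intro exI[of _ "\<pi> @ [(word_val \<iota> (rev V), t, y)]"]) (simp add: right(1) val A)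
  qed
qed

section \<open>Invariance under reduction\<close>

lemma word_step_append:
  assumes "word_step G R w w'" "p \<in> lists G" "q \<in> lists G"
  shows "word_step G R (p @ w @ q) (p @ w' @ q)"
proof -
  obtain w1 w2 l r where "w1 \<in> lists G" "w2 \<in> lists G" "(l, r) \<in> R"
    "w = w1 @ l @ w2" "w' = w1 @ r @ w2"
    using assms(1) unfolding word_step_def by blast
  then have "p @ w1 \<in> lists G \<and> w2 @ q \<in> lists G \<and> (l, r) \<in> R \<and>
      p @ w @ q = (p @ w1) @ l @ (w2 @ q) \<and> p @ w' @ q = (p @ w1) @ r @ (w2 @ q)"
    using assms(2,3) by simp
  then show ?thesis
    unfolding word_step_def by - (rule exI[of _ "p @ w1"], rule exI[of _ "w2 @ q"], rule exI, rule exI)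
qed

text \<open>Only a prefix may be added, since its letters act later; a suffix would separate the
  letter being applied from the point.\<close>

lemma pair_step_append:
  assumes "pair_step G R \<iota> \<alpha> (w, x) (w', x')" "p \<in> lists G"
  shows "pair_step G R \<iota> \<alpha> (p @ w, x) (p @ w', x')"
proof -
  consider v g where "v \<in> lists G" "g \<in> G" "\<alpha> (\<iota> g) x = Some x'" "w = v @ [g]" "w' = v"
    | "word_step G R w w'" "x' = x"
    using assms(1) unfolding pair_step_def by auto
  then show ?thesis
  proof cases
    case 1
    then show ?thesis
      unfolding pair_step_def using assms(2) by (intro disjI1 exI[of _ "p @ v"] exI[of _ g]) auto
  next
    case 2
    then show ?thesis
      unfolding pair_step_def using word_step_append[OF 2(1) assms(2), of "[]"] by auto
  qed
qed

lemma rtranclp_pair_step_append: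
  assumes "(pair_step G R \<iota> \<alpha>)\<^sup>*\<^sup>* (w, x) (w', x')" "p \<in> lists G"
  shows "(pair_step G R \<iota> \<alpha>)\<^sup>*\<^sup>* (p @ w, x) (p @ w', x')"
  using assms(1)
  by (induction rule: rtranclp_induct2)
    (auto intro: rtranclp.rtrancl_into_rtrancl pair_step_append[OF _ assms(2)])

lemma equivclp_pair_step_word:
  assumes "equivclp (word_step G R) w w'"
  shows "equivclp (pair_step G R \<iota> \<alpha>) (w, x) (w', x)"
  using assms
proof (induction rule: equivclp_induct)
  case (step y z)
  then have "pair_step G R \<iota> \<alpha> (y, x) (z, x) \<or> pair_step G R \<iota> \<alpha> (z, x) (y, x)"
    unfolding pair_step_def by auto
  with step.IH show ?case by (rule equivclp_into_equivclp)
qed simp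

text \<open>Letters next to the point are applied as long as they are defined there. No rule of the
  presentation becomes applicable on the way, because a prefix of a normal word is normal, and each
  application preserves \<open>zigzag\<close> by \<open>zigzag_apply_right\<close>.\<close>

lemma zigzag_pair_normal_form:
  assumes d: "weak_pseudometric d"
    and ne: "non_expansive d A"
    and A: "A = (\<lambda>g. \<alpha> (\<iota> g))"
    and "w \<in> lists G" "is_normal (word_step G R) w"
  shows "\<exists>w' y'. is_normal_form (pair_step G R \<iota> \<alpha>) (w, y) (w', y') \<and>
    zigzag d A U x (rev w) y = zigzag d A U x (rev w') y'"
  using assms(4,5)
proof (induction w arbitrary: y rule: rev_induct)
  case Nil
  then have "is_normal (pair_step G R \<iota> \<alpha>) ([], y)"
    by (auto simp: is_normal_def pair_step_def)
  then show ?case by (intro exI[of _ "[]"] exI[of _ y]) (simp add: is_normal_form_def)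
next
  case (snoc g w)
  show ?case
  proof (cases "A g y")
    case None
    then have "is_normal (pair_step G R \<iota> \<alpha>) (w @ [g], y)"
      using snoc.prems(2) by (auto simp: is_normal_def pair_step_def A)
    then show ?thesis by (intro exI[of _ "w @ [g]"] exI[of _ y]) (simp add: is_normal_form_def)
  next
    case (Some y')
    have "is_normal (word_step G R) w"
      using snoc.prems word_step_append[of G R w _ "[]" "[g]"] by (auto simp: is_normal_def)
    then obtain w' z where z: "is_normal_form (pair_step G R \<iota> \<alpha>) (w, y') (w', z)"
      "zigzag d A U x (rev w) y' = zigzag d A U x (rev w') z"
      using snoc.IH[of y'] snoc.prems(1) by auto
    have "pair_step G R \<iota> \<alpha> (w @ [g], y) (w, y')"
      using Some snoc.prems(1) by (auto simp: pair_step_def A)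
    then have "is_normal_form (pair_step G R \<iota> \<alpha>) (w @ [g], y) (w', z)"
      using z(1) unfolding is_normal_form_def by (meson equivclp_trans r_into_equivclp)
    moreover have "zigzag d A U x (rev (w @ [g])) y = zigzag d A U x (rev w') z"
      using zigzag_apply_right[where A = A and h = g, OF d ne Some] z(2) by simp
    ultimately show ?thesis by blast
  qed
qed

lemma normal_word:
  assumes "confluent_action G R \<iota> \<alpha>"
  shows "normal_word G R \<iota> u \<in> lists G" "word_val \<iota> (normal_word G R \<iota> u) = u"
    "is_normal (word_step G R) (normal_word G R \<iota> u)"
  using theI'[OF ex1_normal_word[of G R \<iota> u]] assms
  unfolding normal_word_def[symmetric] confluent_action_def by auto

text \<open>Both pairs turn out to be equivalent under \<open>pair_step\<close>, so they share their
  unique normal form, and each has the same \<open>zigzag\<close> value as that form.\<close>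

lemma zigzag_glob_step:
  assumes d: "weak_pseudometric d"
    and ne: "non_expansive d A"
    and A: "A = (\<lambda>g. \<alpha> (\<iota> g))"
    and conf: "confluent_action G R \<iota> \<alpha>"
    and step: "glob_step \<alpha> (w, y) (w', y')"
  shows "zigzag d A U x (rev (normal_word G R \<iota> w)) y = zigzag d A U x (rev (normal_word G R \<iota> w')) y'"
proof -
  let ?n = "normal_word G R \<iota>" and ?r = "pair_step G R \<iota> \<alpha>"
  note n = normal_word[OF conf]
  obtain v where v: "\<alpha> v y = Some y'" "w = w' * v"
    using step unfolding glob_step_def by auto
  have lists: "?n w' @ ?n v \<in> lists G" using n(1) by simp
  have "word_val \<iota> (?n w) = word_val \<iota> (?n w' @ ?n v)"
    using n(2) by (simp add: v(2)) (simp add: word_val_def)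
  then have "equivclp (word_step G R) (?n w) (?n w' @ ?n v)"
    using conf lists n(1) unfolding confluent_action_def presents_def by blast
  then have "equivclp ?r (?n w, y) (?n w' @ ?n v, y)"
    by (rule equivclp_pair_step_word)
  \<comment> \<open>Confluence of the action lets the word of \<open>v\<close> be used up letter by
    letter, with the word of \<open>w'\<close> carried along as a prefix.\<close>
  also have "?r\<^sup>*\<^sup>* (?n v, y) ([], y')"
    using conf v(1) n(1,2) unfolding confluent_action_def by metis
  then have "equivclp ?r (?n w' @ ?n v, y) (?n w', y')"
    using rtranclp_pair_step_append[OF _ n(1)[of w']] by (metis append_Nil2 rtranclp_into_equivclp)
  finally (equivclp_trans) have eq: "equivclp ?r (?n w, y) (?n w', y')" .
  obtain p z where p: "is_normal_form ?r (?n w, y) (p, z)"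
    "zigzag d A U x (rev (?n w)) y = zigzag d A U x (rev p) z"
    using zigzag_pair_normal_form[where A = A and \<alpha> = \<alpha> and \<iota> = \<iota>, OF d ne A n(1,3)] by blast
  obtain p' z' where p': "is_normal_form ?r (?n w', y') (p', z')"
    "zigzag d A U x (rev (?n w')) y' = zigzag d A U x (rev p') z'"
    using zigzag_pair_normal_form[where A = A and \<alpha> = \<alpha> and \<iota> = \<iota>, OF d ne A n(1,3)] by blast
  have "is_normal_form ?r (?n w, y) (p', z')"
    using eq p'(1) unfolding is_normal_form_def by (meson equivclp_trans)
  then have "(p, z) = (p', z')"
    using p(1) conf n(1) unfolding confluent_action_def by blast
  then show ?thesis using p(2) p'(2) by simp
qed

lemma zigzag_glob_class:
  assumes "weak_pseudometric d"
    and "non_expansive d A"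
    and "A = (\<lambda>g. \<alpha> (\<iota> g))"
    and "confluent_action G R \<iota> \<alpha>"
    and "glob_class \<alpha> w y = glob_class \<alpha> w' y'"
  shows "zigzag d A U x (rev (normal_word G R \<iota> w)) y = zigzag d A U x (rev (normal_word G R \<iota> w')) y'"
proof -
  let ?f = "\<lambda>(w, y). zigzag d A U x (rev (normal_word G R \<iota> w)) y"
  have f_step: "?f p = ?f q" if "glob_step \<alpha> p q" for p q
  proof -
    obtain w y w' y' where pq: "p = (w, y)" "q = (w', y')" by fastforce
    show ?thesis
      unfolding pq prod.case
      by (rule zigzag_glob_step[OF assms(1-4) that[unfolded pq]])
  qed
  have "equivclp (glob_step \<alpha>) (w, y) (w', y')"
    using assms(5) by (simp add: glob_class_eq_iff)
  then have "?f (w, y) = ?f (w', y')"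
  proof (induction rule: equivclp_induct)
    case (step p q)
    then have "?f p = ?f q"
      using f_step[of p q] f_step[of q p] by (elim disjE) (simp_all only:)
    with step.IH show ?case by (rule trans)
  qed (rule refl)
  then show ?thesis by simp
qed

text \<open>Along a segment the word is constant and the Lipschitz bound applies; between
  consecutive segments only the representative of a class changes, which leaves
  \<open>zigzag\<close> unchanged.\<close>

lemma zigzag_le_path_length:
  assumes d: "weak_pseudometric d"
    and ne: "non_expansive d A"
    and A: "A = (\<lambda>g. \<alpha> (\<iota> g))"
    and conf: "confluent_action G R \<iota> \<alpha>"
    and path: "is_path \<alpha> \<pi> (glob_class \<alpha> v s) (glob_class \<alpha> w t)"
  shows "zigzag d A U x (rev (normal_word G R \<iota> w)) t
    \<le> zigzag d A U x (rev (normal_word G R \<iota> v)) s + path_length d \<pi>"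
  using path
proof (induction \<pi> arbitrary: v s)
  case Nil
  then show ?case by (simp add: is_path_def)
next
  case (Cons p \<pi>)
  obtain u s' t' where p: "p = (u, s', t')" by (cases p)
  let ?f = "\<lambda>w. zigzag d A U x (rev (normal_word G R \<iota> w))"
  note cong = zigzag_glob_class[where A = A and \<alpha> = \<alpha> and \<iota> = \<iota>, OF d ne A conf]
  have "?f w t \<le> ?f u t' + path_length d \<pi>"
  proof (cases "\<pi> = []")
    case True
    then have "?f w t = ?f u t'"
      by (intro cong) (use Cons.prems in \<open>simp add: p is_path_Cons\<close>)
    then show ?thesis by (simp add: True)
  next
    case False
    then have "is_path \<alpha> \<pi> (glob_class \<alpha> u t') (glob_class \<alpha> w t)"
      using Cons.prems by (simp add: p is_path_Cons)
    then show ?thesis by (rule Cons.IH)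
  qed
  also have "\<dots> \<le> (?f u s' + d s' t') + path_length d \<pi>"
    by (intro add_right_mono zigzag_lipschitz_right d)
  also have "?f u s' = ?f v s"
    by (rule cong) (use Cons.prems in \<open>simp add: p is_path_Cons\<close>)
  finally show ?case by (simp add: p add.assoc)
qed

section \<open>Existence of geodesics\<close>

lemma ex_geodesic:
  assumes d: "weak_pseudometric d"
    and "non_expansive d \<alpha>"
    and conf: "confluent_action G R \<iota> \<alpha>"
    and C: "C_element G R \<iota> d \<alpha> u" "C_element G R \<iota> d \<alpha> v"
    and path: "is_path \<alpha> \<pi> (glob_class \<alpha> u x) (glob_class \<alpha> v y)"
  shows "\<exists>\<pi>. geodesic d \<alpha> \<pi> (glob_class \<alpha> u x) (glob_class \<alpha> v y)"
proof -
  define A where A: "A = (\<lambda>g. \<alpha> (\<iota> g))"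
  have ne: "non_expansive d A"
    using assms(2) unfolding non_expansive_def act_dom_def A by blast
  let ?z = "zigzag d A (rev (normal_word G R \<iota> u)) x (rev (normal_word G R \<iota> v)) y"
  let ?D = "glob_dist d \<alpha> (glob_class \<alpha> u x) (glob_class \<alpha> v y)"
  \<comment> \<open>The reference pair is taken to be the start of the path, where
    \<open>zigzag\<close> vanishes.\<close>
  have "?z \<le> path_length d \<rho>" if "is_path \<alpha> \<rho> (glob_class \<alpha> u x) (glob_class \<alpha> v y)" for \<rho>
    using zigzag_le_path_length[where A = A and \<alpha> = \<alpha> and \<iota> = \<iota>, OF d ne A conf that, of "rev (normal_word G R \<iota> u)" x]
    by (simp add: zigzag_refl[OF d])
  then have le: "?z \<le> ?D" unfolding glob_dist_def by (auto intro: INF_greatest)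
  have ge: "?D \<le> path_length d \<rho>" if "is_path \<alpha> \<rho> (glob_class \<alpha> u x) (glob_class \<alpha> v y)" for \<rho>
    unfolding glob_dist_def using that by (auto intro: INF_lower)
  show ?thesis
  proof (cases "?z = top")
    \<comment> \<open>All paths then have infinite length, so the given one is geodesic.\<close>
    case True
    then have "geodesic d \<alpha> \<pi> (glob_class \<alpha> u x) (glob_class \<alpha> v y)"
      using le ge[OF path] path by (simp add: geodesic_def top_unique)
    then show ?thesis ..
  next
    case False
    then obtain \<rho> where "is_path \<alpha> \<rho> (glob_class \<alpha> u x) (glob_class \<alpha> v y)" "path_length d \<rho> = ?z"
      using zigzag_path[where A = A and \<alpha> = \<alpha> and \<iota> = \<iota>, OF d ne A, of "rev (normal_word G R \<iota> u)" x "rev (normal_word G R \<iota> v)" y]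
        C normal_word(2)[OF conf] by (auto simp: C_element_def less_top)
    then show ?thesis using le ge unfolding geodesic_def by (metis antisym)
  qed
qed

theorem theorem5p22:
  fixes d :: "'x \<Rightarrow> 'x \<Rightarrow> ennreal"
    and \<alpha> :: "'m::monoid_mult \<Rightarrow> 'x \<Rightarrow> 'x option"
    and G :: "'g set" and R :: "('g list \<times> 'g list) set" and \<iota> :: "'g \<Rightarrow> 'm"
  assumes "weak_pseudometric d"
    and "partial_action \<alpha>"
    and "non_expansive d \<alpha>"
    and "confluent_action G R \<iota> \<alpha>"
  shows "(\<forall>u v x y. C_element G R \<iota> d \<alpha> u \<and> C_element G R \<iota> d \<alpha> v \<and>
            normal_at G R \<iota> \<alpha> u x \<and> normal_at G R \<iota> \<alpha> v y \<and>
            (\<exists>\<pi>. is_path \<alpha> \<pi> (glob_class \<alpha> u x) (glob_class \<alpha> v y)) \<longrightarrow>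
            (\<exists>\<pi>. geodesic d \<alpha> \<pi> (glob_class \<alpha> u x) (glob_class \<alpha> v y))) \<and>
         (compact_action G \<iota> d \<alpha> \<longrightarrow>
            (\<forall>a\<in>glob_carrier \<alpha>. \<forall>b\<in>glob_carrier \<alpha>.
               (\<exists>\<pi>. is_path \<alpha> \<pi> a b) \<longrightarrow> (\<exists>\<pi>. geodesic d \<alpha> \<pi> a b)))"
proof (intro conjI allI impI ballI; (elim conjE exE)?)
  fix u v x y \<pi>
  assume "C_element G R \<iota> d \<alpha> u" "C_element G R \<iota> d \<alpha> v"
    "is_path \<alpha> \<pi> (glob_class \<alpha> u x) (glob_class \<alpha> v y)"
  then show "\<exists>\<pi>. geodesic d \<alpha> \<pi> (glob_class \<alpha> u x) (glob_class \<alpha> v y)"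
    by (rule ex_geodesic[OF assms(1,3,4)])
next
  fix a b \<pi>
  assume comp: "compact_action G \<iota> d \<alpha>" and ab: "a \<in> glob_carrier \<alpha>" "b \<in> glob_carrier \<alpha>"
    and path: "is_path \<alpha> \<pi> a b"
  \<comment> \<open>Normal words are words over \<open>G\<close>, and all letters of
    \<open>G\<close> have compact domains.\<close>
  have C: "C_element G R \<iota> d \<alpha> u" for u
    using comp normal_word(1)[OF assms(4), of u]
    unfolding C_element_def compact_action_def by auto
  have "\<exists>u x. c = glob_class \<alpha> u x" if "c \<in> glob_carrier \<alpha>" for c
    using that unfolding glob_carrier_def glob_class_def by (auto elim!: quotientE)
  then obtain u x v y where "a = glob_class \<alpha> u x" "b = glob_class \<alpha> v y"
    using ab by metis
  then show "\<exists>\<pi>. geodesic d \<alpha> \<pi> a b"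
    using ex_geodesic[OF assms(1,3,4) C C] path by blast
qed

end
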